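(* Let $k\in\{3,4\}$ and $q=p^m$ for some prime $p$ and $m\in\mathbb{N}$. If $p\equiv1\pmod k$, with $m$ even if $k=4$, then $\Gamma(k,q)$ is Ramanujan.
   Context: For $k\mid q-1$, the generalized Paley graph $\Gamma(k,q)$ is the Cayley graph with vertex set $\mathbb{F}_q$ and $u,v$ adjacent iff $v-u\in\{x^k:x\in\mathbb{F}_q^*\}$; it is $n$-regular with $n=\frac{q-1}{k}$ (and undirected in all the cases considered here). A connected $n$-regular undirected graph $G$ is Ramanujan if $\lambda(G)\le2\sqrt{n-1}$, where $\lambda(G)=\max\{|\lambda|:\lambda\in\mathrm{Spec}(G),\ |\lambda|\ne n\}$ and $\mathrm{Spec}(G)$ is the set of eigenvalues of the adjacency matrix. *)

theory Defs
  imports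
    "Graph_Theory.Graph_Theory"
    "Jordan_Normal_Form.Spectral_Radius"
    "HOL-Number_Theory.Cong"
    "HOL-Library.Cardinality"
begin

definition cayley_digraph :: "'a::ab_group_add set \<Rightarrow> 'a pair_pre_digraph" where
  "cayley_digraph S = \<lparr> pverts = UNIV, parcs = {(u, v). v - u \<in> S} \<rparr>"

(* \<Gamma>(k,q), where the finite field with q elements is the type 'a and q = CARD('a). *)
definition gen_paley :: "nat \<Rightarrow> 'a::{field,finite} pair_pre_digraph" where
  "gen_paley k = cayley_digraph {x ^ k |x. x \<noteq> 0}"

(* The matrix type of Jordan_Normal_Form is indexed by natural numbers, so the vertices are
   listed in an arbitrary order; all orders give similar matrices, hence the same spectrum. *)
definition vertex_list :: "'a pair_pre_digraph \<Rightarrow> 'a list" where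
  "vertex_list G = (SOME vs. distinct vs \<and> set vs = pverts G)"

definition adjacency_matrix :: "'a pair_pre_digraph \<Rightarrow> complex mat" where
  "adjacency_matrix G = (let vs = vertex_list G in
     mat (length vs) (length vs) (\<lambda>(i, j). if (vs ! i, vs ! j) \<in> parcs G then 1 else 0))"

definition graph_spectrum :: "'a pair_pre_digraph \<Rightarrow> complex set" where
  "graph_spectrum G = spectrum (adjacency_matrix G)"

(* Only used for undirected graphs, where in-degrees and out-degrees agree. *)
definition regular_graph :: "nat \<Rightarrow> 'a pair_pre_digraph \<Rightarrow> bool" where
  "regular_graph n G \<longleftrightarrow> (\<forall>v \<in> pverts G. out_degree (with_proj G) v = n)"

(* \<lambda>(G) of an n-regular graph G. The maximum is over a finite set; it is unspecified if the
   set is empty, which for connected n-regular graphs happens only for one or two vertices. *)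
definition second_eigenvalue :: "nat \<Rightarrow> 'a pair_pre_digraph \<Rightarrow> real" where
  "second_eigenvalue n G = Max {cmod \<mu> |\<mu>. \<mu> \<in> graph_spectrum G \<and> cmod \<mu> \<noteq> real n}"

(* pair_graph: finite, undirected (symmetric arc set), without loops.
   The degree n is unique because connected graphs are nonempty. *)
definition ramanujan :: "'a pair_pre_digraph \<Rightarrow> bool" where
  "ramanujan G \<longleftrightarrow> pair_graph G \<and> Digraph_Component.connected (with_proj G) \<and>
     (\<exists>n. regular_graph n G \<and> second_eigenvalue n G \<le> 2 * sqrt (real n - 1))"

end

theory Submission
  imports "HOL-Analysis.Complex_Transcendental" "HOL-Number_Theory.Residues" Defs
begin

text \<open>
  Let \<open>q\<close> be the size of the field and \<open>S\<close> the group of nonzero \<open>k\<close>-th powers, of order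
  \<open>n = (q - 1) / k\<close>. Fourier analysis on the additive group shows that the eigenvalues of the
  graph are the Gaussian periods \<open>\<eta> a = (\<Sum>s\<in>S. \<psi> (s * a))\<close>, where \<open>\<psi>\<close> is a fixed nontrivial
  additive character and \<open>a\<close> ranges over the field; \<open>\<eta> 0 = n\<close> is the trivial one.

  No evaluation of Gauss sums is needed to bound the others. Parseval's identity gives
  \<open>(\<Sum>a. \<bar>\<eta> a\<bar>\<^sup>2) = q * n\<close>, and for \<open>a \<noteq> 0\<close> the \<open>n\<close> elements of \<open>S * a\<close> all have
  the same period as \<open>a\<close>. Hence \<open>n\<^sup>2 + n * \<bar>\<eta> a\<bar>\<^sup>2 \<le> q * n\<close>, that is,
  \<open>\<bar>\<eta> a\<bar>\<^sup>2 \<le> q - n\<close>, and this is at most \<open>4 * (n - 1)\<close> for \<open>k = 3\<close>, \<open>n \<ge> 3\<close> and for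
  \<open>k = 4\<close>, \<open>n \<ge> 5\<close>; for \<open>k = 4\<close> always \<open>q \<ge> 25\<close>, as \<open>q\<close> is a square. In the
  remaining case \<open>k = 3\<close>, \<open>q = 7\<close> the graph is a cycle of length 7
  and the bound is trivial. Parseval's identity also shows that not every period has modulus
  \<open>n\<close>, so that the maximum defining the second eigenvalue is over a nonempty set.

  The graph is undirected because \<open>-1\<close> is a \<open>k\<close>-th power, which for \<open>k = 4\<close> uses that \<open>m\<close>
  is even. It is connected because the component of 0 is an additive subgroup with at least
  \<open>n + 1 > q / p\<close> elements, where \<open>k < p\<close> gives the inequality, while a proper
  subgroup has at most \<open>q / p\<close>.
\<close>

section \<open>Powers in finite fields\<close>

lemma card_power_eq_le:
  fixes c :: "'a::field"
  assumes "n > 0"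
  shows "card {x. x ^ n = c} \<le> n"
proof -
  let ?P = "monom 1 n - [:c:]"
  have deg: "degree ?P = n"
    using assms by (subst diff_conv_add_uminus, subst degree_add_eq_left)
      (auto simp: degree_monom_eq)
  then have "?P \<noteq> 0"
    using assms by auto
  from card_poly_roots_bound[OF this] show ?thesis
    by (simp add: deg poly_monom)
qed

lemma finite_field_power_card_minus_one:
  fixes x :: "'a::{field,finite}"
  assumes "x \<noteq> 0"
  shows "x ^ (CARD('a) - 1) = 1"
proof -
  have "(\<Prod>y\<in>UNIV-{0}. x * y) = (\<Prod>y\<in>UNIV-{0}. y)"
    by (rule prod.reindex_bij_witness[of _ "\<lambda>y. y / x" "\<lambda>y. x * y"]) (use assms in auto)
  then show ?thesis
    by (simp add: prod.distrib card_Diff_singleton)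
qed

text \<open>
  Both statements follow by counting, without using that the multiplicative group is cyclic:
  each fibre of \<open>x \<mapsto> x ^ k\<close> has at most \<open>k\<close> elements, so there are at least \<open>n\<close> powers, and
  all of them are among the at most \<open>n\<close> roots of \<open>x ^ n = 1\<close>.
\<close>

lemma finite_field_powers:
  assumes "k * n = CARD('a::{field,finite}) - 1" "n > 0"
  shows "card {x ^ k |x::'a. x \<noteq> 0} = n"
    and "{x ^ k |x::'a. x \<noteq> 0} = {x. x ^ n = 1}"
proof -
  let ?S = "{x ^ k |x::'a. x \<noteq> 0}"
  have "card (UNIV::'a set) > 1"
    using card_mono[of UNIV "{0, 1 :: 'a}"] by simp
  then have k: "k > 0"
    using assms by (cases k) auto
  have sub: "?S \<subseteq> {x. x ^ n = 1}"
    using finite_field_power_card_minus_one assms(1) by (auto simp flip: power_mult)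
  have le: "card {x::'a. x ^ n = 1} \<le> n"
    using card_power_eq_le assms by blast
  have "k * n = card (UNIV - {0::'a})"
    using assms by (simp add: card_Diff_singleton)
  also have "UNIV - {0::'a} = (\<Union>s\<in>?S. {x. x \<noteq> 0 \<and> x ^ k = s})"
    by auto
  also have "card \<dots> \<le> (\<Sum>s\<in>?S. card {x. x \<noteq> 0 \<and> x ^ k = s})"
    by (rule card_UN_le) auto
  also have "\<dots> \<le> (\<Sum>s\<in>?S. k)"
  proof (rule sum_mono)
    fix s :: 'a
    have "card {x. x \<noteq> 0 \<and> x ^ k = s} \<le> card {x. x ^ k = s}"
      by (rule card_mono) auto
    also have "\<dots> \<le> k"
      using card_power_eq_le k by blast
    finally show "card {x. x \<noteq> 0 \<and> x ^ k = s} \<le> k" .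
  qed
  finally have ge: "n \<le> card ?S"
    using k by simp
  show "?S = {x. x ^ n = 1}"
    using ge le by (intro card_seteq sub) auto
  then show "card ?S = n"
    using ge le by simp
qed

section \<open>Additive characters of a finite field\<close>

text \<open>A nontrivial homomorphism from the additive group of a finite field to the unit circle.\<close>

locale additive_character =
  fixes \<psi> :: "'a::{field,finite} \<Rightarrow> complex"
  assumes add: "\<psi> (x + y) = \<psi> x * \<psi> y"
    and norm_1 [simp]: "cmod (\<psi> x) = 1"
    and nontrivial: "\<exists>x. \<psi> x \<noteq> 1"
begin

lemma zero [simp]: "\<psi> 0 = 1"
proof -
  have "\<psi> 0 * \<psi> 0 = \<psi> 0"
    using add[of 0 0] by simp
  moreover have "\<psi> 0 \<noteq> 0"
    using norm_1[of 0] by fastforce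
  ultimately show ?thesis by simp
qed

lemma cnj_eq: "cnj (\<psi> x) = \<psi> (- x)"
proof -
  have "\<psi> x * \<psi> (- x) = 1"
    using add[of x "- x"] by simp
  moreover have "\<psi> x * cnj (\<psi> x) = 1"
    by (simp flip: complex_norm_square)
  moreover have "\<psi> x \<noteq> 0"
    using norm_1[of x] by fastforce
  ultimately show ?thesis
    by (metis mult_left_cancel)
qed

lemma orthogonality: "(\<Sum>x\<in>UNIV. \<psi> (x * a)) = (if a = 0 then of_nat CARD('a) else 0)"
proof (cases "a = 0")
  case False
  obtain y where y: "\<psi> y \<noteq> 1"
    using nontrivial by blast
  have "\<psi> y * (\<Sum>x\<in>UNIV. \<psi> (x * a)) = (\<Sum>x\<in>UNIV. \<psi> ((x + y / a) * a))"
    using False by (simp add: sum_distrib_left distrib_right add) (simp add: mult.commute)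
  also have "\<dots> = (\<Sum>x\<in>UNIV. \<psi> (x * a))"
    by (rule sum.reindex_bij_witness[of _ "\<lambda>x. x - y / a" "\<lambda>x. x + y / a"]) auto
  finally show ?thesis
    using y False by simp
qed simp

end

text \<open>
  Composing the trace \<open>x + x ^ p + \<dots> + x ^ p ^ (m - 1)\<close>, whose values lie in the prime field,
  with \<open>j \<mapsto> exp (2 \<pi> i j / p)\<close> gives a character. The trace does not vanish identically,
  since as a polynomial it has degree \<open>p ^ (m - 1)\<close>, which is less than the size of the field.
\<close>

lemma additive_character_exists:
  assumes p: "prime p" and card: "CARD('a::{field,finite}) = p ^ m"
  shows "\<exists>\<psi> :: 'a \<Rightarrow> complex. additive_character \<psi>"
proof -
  have "card {0, 1 :: 'a} \<le> CARD('a)"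
    by (rule card_mono) auto
  then have m: "m > 0"
    using card by (cases m) auto
  have p1: "p > 1"
    using p prime_gt_1_nat by blast
  have pr: "prime CHAR('a)"
    by (intro prime_CHAR_semidom finite_imp_CHAR_pos) simp
  moreover have "CHAR('a) dvd p ^ m"
    using CHAR_dvd_CARD[where 'a = 'a] card by simp
  ultimately have char: "CHAR('a) = p"
    using p prime_dvd_power[of "CHAR('a)" p m] primes_dvd_imp_eq[of "CHAR('a)" p] by simp
  define T :: "'a \<Rightarrow> 'a" where "T x = (\<Sum>i<m. x ^ p ^ i)" for x
  have T_add: "T (x + y) = T x + T y" for x y
    using pr by (simp add: T_def freshmans_dream'[OF pr refl] sum.distrib flip: char)
  have "T x ^ p = T x" for x
  proof -
    have "x ^ p ^ m = x"
    proof (cases "x = 0")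
      case False
      have "x ^ p ^ m = x * x ^ (p ^ m - 1)"
        using p1 by (simp flip: power_Suc)
      then show ?thesis
        using finite_field_power_card_minus_one[OF False] card by simp
    qed (use p1 in simp)
    have "T x ^ p = (\<Sum>i<m. (x ^ p ^ i) ^ p)"
      unfolding T_def using pr char by (intro freshmans_dream_sum) auto
    also have "\<dots> = (\<Sum>i<m. x ^ p ^ Suc i)"
      by (simp add: mult.commute flip: power_mult)
    also have "\<dots> = (\<Sum>i<Suc m. x ^ p ^ i) - x"
      by (subst sum.lessThan_Suc_shift) simp
    also have "\<dots> = T x"
      using \<open>x ^ p ^ m = x\<close> by (simp add: T_def)
    finally show ?thesis .
  qed
  \<comment> \<open>The prime field consists of all roots of \<open>y ^ p = y\<close>, hence contains the values of \<open>T\<close>.\<close>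
  moreover have "{y::'a. y ^ p = y} = of_nat ` {..<p}"
  proof (rule sym, rule card_seteq)
    show "of_nat ` {..<p} \<subseteq> {y::'a. y ^ p = y}"
    proof
      fix y :: 'a assume "y \<in> of_nat ` {..<p}"
      then obtain j where "y = of_nat j" by blast
      moreover have "(of_nat j :: 'a) ^ p = of_nat j" for j
      proof (induction j)
        case (Suc j)
        have "(1 + of_nat j :: 'a) ^ p = 1 ^ p + of_nat j ^ p"
          using pr char by (intro freshmans_dream) simp_all
        with Suc show ?case
          by simp
      qed (use p1 in simp)
      ultimately show "y \<in> {y. y ^ p = y}"
        by simp
    qed
    have "card (of_nat ` {..<p} :: 'a set) = p"
      by (subst card_image)
        (auto simp: inj_on_def of_nat_eq_iff_cong_CHAR char cong_def)
    moreover have "card {y::'a. y ^ p = y} \<le> p"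
    proof -
      let ?P = "monom 1 p - [:0, 1 :: 'a:]"
      have "degree ?P = p"
        unfolding diff_conv_add_uminus using p1
        by (subst degree_add_eq_left) (simp_all add: degree_monom_eq)
      moreover from this have "?P \<noteq> 0"
        using p1 by force
      moreover have "{y. poly ?P y = 0} = {y::'a. y ^ p = y}"
        by (simp add: poly_monom)
      ultimately show ?thesis
        using card_poly_roots_bound[of ?P] by simp
    qed
    ultimately show "card {y::'a. y ^ p = y} \<le> card (of_nat ` {..<p} :: 'a set)"
      by simp
  qed auto
  ultimately have "\<exists>j. T x = of_nat j" for x
    by blast
  then obtain j where j: "\<And>x. T x = of_nat (j x)"
    by metis
  define \<psi> where "\<psi> x = exp (2 * of_real pi * \<i> * of_nat (j x) / of_nat p)" for x
  have exp_eq: "exp (2 * of_real pi * \<i> * of_nat a / of_nat p) =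
      exp (2 * of_real pi * \<i> * of_nat b / of_nat p) \<longleftrightarrow> (of_nat a :: 'a) = of_nat b" for a b
    using complex_root_unity_eq[of p a b] p1 by (simp add: of_nat_eq_iff_cong_CHAR char cong_def)
  have "additive_character \<psi>"
  proof
    fix x y
    have "(of_nat (j (x + y)) :: 'a) = of_nat (j x + j y)"
      using T_add[of x y] by (simp add: j)
    then have "\<psi> (x + y) = exp (2 * of_real pi * \<i> * of_nat (j x + j y) / of_nat p)"
      unfolding \<psi>_def using exp_eq by blast
    then show "\<psi> (x + y) = \<psi> x * \<psi> y"
      by (simp add: \<psi>_def exp_add add_divide_distrib distrib_left)
  next
    show "cmod (\<psi> x) = 1" for x
      by (simp add: \<psi>_def norm_exp_eq_Re)
  next
    let ?P = "\<Sum>i<m. monom (1::'a) (p ^ i)"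
    have "coeff ?P 1 = (\<Sum>i<m. if i = 0 then 1 else 0)"
      using p1 by (simp add: coeff_sum power_eq_1_iff if_distrib cong: if_cong)
    then have "?P \<noteq> 0"
      using m by (intro notI) simp
    have "degree ?P \<le> p ^ (m - 1)"
      using p1 by (intro degree_sum_le) (auto intro!: order.trans[OF degree_monom_le] power_increasing)
    also have "\<dots> < CARD('a)"
      using card p1 m by simp
    finally have "card {x. poly ?P x = 0} \<noteq> CARD('a)"
      using card_poly_roots_bound[OF \<open>?P \<noteq> 0\<close>] by linarith
    then have "{x. poly ?P x = 0} \<noteq> UNIV"
      by metis
    then have "\<exists>x. poly ?P x \<noteq> 0"
      by blast
    then obtain x where "T x \<noteq> 0"
      by (auto simp: T_def poly_sum poly_monom)
    then have "\<psi> x \<noteq> 1"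
      using exp_eq[of "j x" 0] j by (simp add: \<psi>_def)
    then show "\<exists>x. \<psi> x \<noteq> 1" ..
  qed
  then show ?thesis
    by blast
qed

section \<open>Cayley graphs of finite abelian groups\<close>

lemma card_additive_subgroup_dvd:
  fixes H :: "'a::{ab_group_add,finite} set"
  assumes "0 \<in> H" "\<And>x y. x \<in> H \<Longrightarrow> y \<in> H \<Longrightarrow> x + y \<in> H" "\<And>x. x \<in> H \<Longrightarrow> - x \<in> H"
  shows "card H dvd CARD('a)"
proof -
  define G where "G = \<lparr>carrier = (UNIV :: 'a set), monoid.mult = (+), one = (0 :: 'a)\<rparr>"
  interpret group G
  proof (rule groupI)
    fix x assume "x \<in> carrier G"
    show "\<exists>y\<in>carrier G. y \<otimes>\<^bsub>G\<^esub> x = \<one>\<^bsub>G\<^esub>"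
      by (intro bexI[of _ "- x"]) (auto simp: G_def)
  qed (auto simp: G_def add_ac)
  have "inv\<^bsub>G\<^esub> x = - x" for x
    by (intro inv_equality) (auto simp: G_def)
  then have "subgroup H G"
    using assms by (intro subgroup.intro) (auto simp: G_def)
  from lagrange[OF this] have "card (rcosets\<^bsub>G\<^esub> H) * card H = CARD('a)"
    by (simp add: Coset.order_def G_def)
  then show ?thesis
    by (metis dvd_triv_right)
qed

lemma pair_graph_cayley_digraph:
  fixes S :: "'a::{ab_group_add,finite} set"
  assumes "0 \<notin> S" "\<And>x. x \<in> S \<Longrightarrow> - x \<in> S"
  shows "pair_graph (cayley_digraph S)"
proof
  have "v - u \<in> S \<longleftrightarrow> u - v \<in> S" for u v
    using assms(2)[of "v - u"] assms(2)[of "u - v"] by auto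
  then show "symmetric (with_proj (cayley_digraph S))"
    by (auto simp: symmetric_def cayley_digraph_def sym_def)
qed (use assms in \<open>auto simp: cayley_digraph_def\<close>)

lemma regular_cayley_digraph:
  fixes S :: "'a::{ab_group_add,finite} set"
  shows "regular_graph (card S) (cayley_digraph S)"
proof -
  have "card {e \<in> {(u, w). w - u \<in> S}. fst e = v} = card S" for v
    by (rule bij_betw_same_card[of "\<lambda>e. snd e - v"])
      (rule bij_betw_byWitness[of _ "\<lambda>s. (v, v + s)"], auto)
  then show ?thesis
    by (simp add: regular_graph_def out_degree_def out_arcs_def cayley_digraph_def)
qed

text \<open>
  The component of 0 is an additive subgroup containing 0 and the connection set, so it has at
  least \<open>card S + 1\<close> elements, while a proper subgroup of a group of order \<open>p ^ m\<close> has index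
  at least \<open>p\<close>.
\<close>

lemma connected_cayley_digraph:
  fixes S :: "'a::{ab_group_add,finite} set"
  assumes "prime p" "CARD('a) = p ^ m" "CARD('a) < p * (card S + 1)"
    and "0 \<notin> S" and S_minus: "\<And>x. x \<in> S \<Longrightarrow> - x \<in> S"
  shows "Digraph_Component.connected (with_proj (cayley_digraph S))"
proof -
  define R where "R = {(u, v). v - u \<in> S}\<^sup>*"
  define H where "H = {x. (0, x) \<in> R}"
  have trans: "(u + c, v + c) \<in> R" if "(u, v) \<in> R" for u v c
    using that unfolding R_def
    by (induction rule: rtrancl_induct) (auto intro: rtrancl_into_rtrancl)
  have "sym {(u, v). v - u \<in> S}"
    using S_minus by (metis (mono_tags, lifting) case_prod_conv mem_Collect_eq minus_diff_eq symI)
  then have sym: "(v, u) \<in> R" if "(u, v) \<in> R" for u v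
    using that unfolding R_def by (meson sym_rtrancl symD)
  have "insert 0 S \<subseteq> H"
    unfolding H_def R_def by (auto intro: r_into_rtrancl)
  then have "card (insert 0 S) \<le> card H"
    by (intro card_mono) auto
  then have "card S + 1 \<le> card H"
    using assms by simp
  then have big: "CARD('a) < p * card H"
    using assms(3) by (meson less_le_trans mult_le_mono2)
  have "card H dvd CARD('a)"
  proof (rule card_additive_subgroup_dvd)
    show "0 \<in> H"
      by (simp add: H_def R_def)
    show "x + y \<in> H" if "x \<in> H" "y \<in> H" for x y
      using that trans[of 0 x y] unfolding H_def R_def by (auto intro: rtrancl_trans)
    show "- x \<in> H" if "x \<in> H" for x
      using that trans[of 0 x "- x"] sym by (auto simp: H_def)
  qed
  then obtain i where i: "i \<le> m" "card H = p ^ i"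
    using assms divides_primepow_nat by auto
  have "i = m"
  proof (rule ccontr)
    assume "i \<noteq> m"
    then have "p ^ Suc i \<le> p ^ m"
      using i assms(1) prime_ge_1_nat by (intro power_increasing) auto
    then show False
      using big i assms(2) by simp
  qed
  then have "H = UNIV"
    using i assms(2) by (intro card_seteq) auto
  then have "(u, v) \<in> R" for u v
    using trans[of 0 "v - u" u] by (auto simp: H_def)
  moreover have "(u, v) \<in> rtrancl_on UNIV {(u, v). v - u \<in> S}" if "(u, v) \<in> R" for u v
    using that unfolding R_def
    by (induction rule: rtrancl_induct) (auto intro: rtrancl_on_into_rtrancl_on)
  ultimately have all: "(u, v) \<in> rtrancl_on UNIV {(u, v). v - u \<in> S}" for u v
    by blast
  interpret pair_graph "cayley_digraph S"
    using assms by (intro pair_graph_cayley_digraph)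
  show ?thesis
    unfolding Digraph_Component.connected_def
  proof (rule strongly_connectedI)
    fix u v :: 'a
    have "u \<rightarrow>\<^sup>*\<^bsub>with_proj (cayley_digraph S)\<^esub> v"
      using all by (simp add: reachable_def cayley_digraph_def)
    then show "u \<rightarrow>\<^sup>*\<^bsub>with_proj (mk_symmetric (with_proj (cayley_digraph S)))\<^esub> v"
      by (rule reachable_mk_symmetricI)
  qed (simp add: cayley_digraph_def)
qed

text \<open>
  Eigenvectors are described as functions on the group, which removes the arbitrary listing of
  the vertices.
\<close>

lemma graph_spectrum_cayley_digraph:
  fixes S :: "'a::{ab_group_add,finite} set"
  shows "\<mu> \<in> graph_spectrum (cayley_digraph S) \<longleftrightarrow>
    (\<exists>f. (\<exists>x. f x \<noteq> 0) \<and> (\<forall>x. (\<Sum>s\<in>S. f (x + s)) = \<mu> * f x))"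
proof -
  define vs where "vs = vertex_list (cayley_digraph S)"
  define q where "q = length vs"
  define A where "A = adjacency_matrix (cayley_digraph S)"
  have "\<exists>vs. distinct vs \<and> set vs = pverts (cayley_digraph S)"
    using finite_distinct_list[of "pverts (cayley_digraph S)"] by auto
  then have "distinct vs \<and> set vs = pverts (cayley_digraph S)"
    unfolding vs_def vertex_list_def by (rule someI_ex)
  then have bij: "bij_betw ((!) vs) {..<q} UNIV"
    unfolding q_def by (intro bij_betw_nth) (auto simp: cayley_digraph_def)
  have all_nth: "(\<forall>i<q. P (vs ! i)) \<longleftrightarrow> (\<forall>x. P x)" for P
  proof -
    have "(\<forall>x\<in>(!) vs ` {..<q}. P x) \<longleftrightarrow> (\<forall>x. P x)"
      using bij by (simp only: bij_betw_def) simp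
    then show ?thesis
      by blast
  qed
  have A: "A = mat q q (\<lambda>(i, j). if vs ! j - vs ! i \<in> S then 1 else 0)"
    by (auto simp: A_def adjacency_matrix_def Let_def q_def vs_def cayley_digraph_def)
  have mult: "(A *\<^sub>v vec q (\<lambda>i. f (vs ! i))) $ i = (\<Sum>s\<in>S. f (vs ! i + s))"
    if "i < q" for f i
  proof -
    have "(A *\<^sub>v vec q (\<lambda>i. f (vs ! i))) $ i =
        (\<Sum>j<q. (if vs ! j - vs ! i \<in> S then 1 else 0) * f (vs ! j))"
      using that by (simp add: A scalar_prod_def lessThan_atLeast0)
    also have "\<dots> = (\<Sum>y\<in>UNIV. (if y - vs ! i \<in> S then 1 else 0) * f y)"
      by (rule sum.reindex_bij_betw[OF bij])
    also have "\<dots> = (\<Sum>y | y - vs ! i \<in> S. f y)"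
      by (rule sum.mono_neutral_cong_right) auto
    also have "\<dots> = (\<Sum>s\<in>S. f (vs ! i + s))"
      by (rule sum.reindex_bij_witness[of _ "\<lambda>s. vs ! i + s" "\<lambda>y. y - vs ! i"]) auto
    finally show ?thesis .
  qed
  have ev: "eigenvector A (vec q (\<lambda>i. f (vs ! i))) \<mu> \<longleftrightarrow>
      (\<exists>x. f x \<noteq> 0) \<and> (\<forall>x. (\<Sum>s\<in>S. f (x + s)) = \<mu> * f x)" for f
  proof -
    have 1: "vec q (\<lambda>i. f (vs ! i)) = 0\<^sub>v q \<longleftrightarrow> (\<forall>x. f x = 0)"
      using all_nth[of "\<lambda>x. f x = 0"] by (simp add: vec_eq_iff)
    have "A *\<^sub>v vec q (\<lambda>i. f (vs ! i)) = \<mu> \<cdot>\<^sub>v vec q (\<lambda>i. f (vs ! i)) \<longleftrightarrow>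
        (\<forall>i<q. (\<Sum>s\<in>S. f (vs ! i + s)) = \<mu> * f (vs ! i))"
      using mult by (auto simp: vec_eq_iff A simp del: index_mult_mat_vec)
    also have "\<dots> \<longleftrightarrow> (\<forall>x. (\<Sum>s\<in>S. f (x + s)) = \<mu> * f x)"
      by (rule all_nth)
    finally show ?thesis
      using 1 by (simp add: eigenvector_def A)
  qed
  have "\<exists>f. v = vec q (\<lambda>i. f (vs ! i))" if "v \<in> carrier_vec q" for v :: "complex vec"
    using that bij
    by (intro exI[of _ "\<lambda>x. v $ inv_into {..<q} ((!) vs) x"])
      (auto simp: bij_betw_def inv_into_f_f)
  moreover have "dim_row A = q"
    by (simp add: A)
  ultimately have "eigenvalue A \<mu> \<longleftrightarrow> (\<exists>f. eigenvector A (vec q (\<lambda>i. f (vs ! i))) \<mu>)"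
    unfolding eigenvalue_def eigenvector_def by metis
  then show ?thesis
    by (simp add: ev graph_spectrum_def spectrum_def flip: A_def)
qed

section \<open>Gaussian periods\<close>

context additive_character
begin

text \<open>
  The sum of the character \<open>x \<mapsto> \<psi> (x * a)\<close> over an arbitrary set \<open>S\<close>; a Gaussian period when
  \<open>S\<close> is a subgroup of the multiplicative group.
\<close>

definition period :: "'a set \<Rightarrow> 'a \<Rightarrow> complex" where
  "period S a = (\<Sum>s\<in>S. \<psi> (s * a))"

lemma period_0: "period S 0 = of_nat (card S)"
  by (simp add: period_def)

lemma cmod_period_le: "cmod (period S a) \<le> card S"
  unfolding period_def using norm_sum[of "\<lambda>s. \<psi> (s * a)" S] by simp

text \<open>
  The characters \<open>x \<mapsto> \<psi> (x * a)\<close> are eigenvectors with eigenvalue \<open>period S a\<close>. They are all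
  that is needed: an eigenvector has a nonzero Fourier coefficient \<open>F a\<close>, and then its
  eigenvalue is \<open>period S a\<close>.
\<close>

lemma graph_spectrum_eq_periods: "graph_spectrum (cayley_digraph S) = range (period S)"
proof (intro equalityI subsetI)
  fix \<mu> assume "\<mu> \<in> range (period S)"
  then obtain a where a: "\<mu> = period S a" by blast
  have "(\<Sum>s\<in>S. \<psi> ((x + s) * a)) = \<mu> * \<psi> (x * a)" for x
    by (simp add: a period_def distrib_right add sum_distrib_right mult.commute[of "\<psi> (x * a)"])
  moreover have "\<psi> (0 * a) \<noteq> 0" by simp
  ultimately show "\<mu> \<in> graph_spectrum (cayley_digraph S)"
    unfolding graph_spectrum_cayley_digraph by (intro exI[of _ "\<lambda>x. \<psi> (x * a)"]) blast
next
  fix \<mu> assume "\<mu> \<in> graph_spectrum (cayley_digraph S)"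
  then obtain f x\<^sub>0 where f: "f x\<^sub>0 \<noteq> 0" "\<And>x. (\<Sum>s\<in>S. f (x + s)) = \<mu> * f x"
    unfolding graph_spectrum_cayley_digraph by blast
  define F where "F a = (\<Sum>x\<in>UNIV. f x * \<psi> (- (x * a)))" for a
  have eq: "\<mu> * F a = period S a * F a" for a
  proof -
    have "\<mu> * F a = (\<Sum>x\<in>UNIV. (\<Sum>s\<in>S. f (x + s)) * \<psi> (- (x * a)))"
      by (simp add: F_def f(2) sum_distrib_left mult.assoc)
    also have "\<dots> = (\<Sum>s\<in>S. \<Sum>x\<in>UNIV. f (x + s) * \<psi> (- (x * a)))"
      by (simp add: sum_distrib_right sum.swap[of _ UNIV])
    also have "\<dots> = (\<Sum>s\<in>S. \<Sum>x\<in>UNIV. f x * \<psi> (- ((x - s) * a)))"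
    proof (rule sum.cong[OF refl])
      fix s
      show "(\<Sum>x\<in>UNIV. f (x + s) * \<psi> (- (x * a))) = (\<Sum>x\<in>UNIV. f x * \<psi> (- ((x - s) * a)))"
        by (rule sum.reindex_bij_witness[of _ "\<lambda>x. x - s" "\<lambda>x. x + s"]) auto
    qed
    also have "\<dots> = (\<Sum>s\<in>S. \<psi> (s * a) * F a)"
    proof -
      have "\<psi> (- ((x - s) * a)) = \<psi> (s * a) * \<psi> (- (x * a))" for x s
        by (simp add: algebra_simps flip: add)
      then show ?thesis
        by (simp add: F_def sum_distrib_left mult_ac)
    qed
    finally show ?thesis
      by (simp add: period_def sum_distrib_right)
  qed
  \<comment> \<open>Fourier inversion at a point where \<open>f\<close> does not vanish\<close>
  have "\<exists>a. F a \<noteq> 0"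
  proof (rule ccontr)
    assume "\<nexists>a. F a \<noteq> 0"
    then have "0 = (\<Sum>a\<in>UNIV. F a * \<psi> (x\<^sub>0 * a))"
      by simp
    also have "\<dots> = (\<Sum>a\<in>UNIV. \<Sum>x\<in>UNIV. f x * \<psi> (a * (x\<^sub>0 - x)))"
    proof -
      have "\<psi> (a * (x\<^sub>0 - x)) = \<psi> (- (x * a)) * \<psi> (x\<^sub>0 * a)" for a x
        by (simp add: algebra_simps flip: add)
      then show ?thesis
        by (simp add: F_def sum_distrib_left mult_ac)
    qed
    also have "\<dots> = (\<Sum>x\<in>UNIV. f x * (\<Sum>a\<in>UNIV. \<psi> (a * (x\<^sub>0 - x))))"
      by (subst sum.swap) (simp add: sum_distrib_left)
    also have "\<dots> = (\<Sum>x\<in>UNIV. if x = x\<^sub>0 then f x * of_nat CARD('a) else 0)"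
      unfolding orthogonality by (intro sum.cong) auto
    also have "\<dots> = f x\<^sub>0 * of_nat CARD('a)"
      by simp
    finally show False
      using f(1) by simp
  qed
  then show "\<mu> \<in> range (period S)"
    using eq by auto
qed

lemma sum_norm_period_squared: "(\<Sum>a\<in>UNIV. (cmod (period S a))\<^sup>2) = CARD('a) * card S"
proof -
  have "complex_of_real (\<Sum>a\<in>UNIV. (cmod (period S a))\<^sup>2) =
      (\<Sum>a\<in>UNIV. \<Sum>s\<in>S. \<Sum>t\<in>S. \<psi> (a * (s - t)))"
  proof -
    have "\<psi> (a * (s - t)) = \<psi> (s * a) * cnj (\<psi> (t * a))" for a s t
      by (simp add: cnj_eq algebra_simps flip: add)
    then show ?thesis
      by (simp add: complex_norm_square period_def sum_product del: of_real_power)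
  qed
  also have "\<dots> = (\<Sum>s\<in>S. \<Sum>t\<in>S. \<Sum>a\<in>UNIV. \<psi> (a * (s - t)))"
    by (simp add: sum.swap[of _ UNIV])
  also have "\<dots> = (\<Sum>s\<in>S. \<Sum>t\<in>S. if s = t then of_nat CARD('a) else 0)"
    unfolding orthogonality by simp
  also have "\<dots> = of_real (CARD('a) * card S)"
    by (simp add: mult.commute)
  finally show ?thesis
    using of_real_eq_iff by blast
qed

text \<open>
  If \<open>S\<close> is a subgroup of the multiplicative group, the period is constant on the coset \<open>S * a\<close>,
  so its value there occurs at least \<open>card S\<close> times in the sum of squares. Closure under
  multiplication suffices as a hypothesis, since the field is finite.
\<close>

lemma norm_period_squared_le:
  assumes "0 \<notin> S" "S \<noteq> {}" and S_mult: "\<And>s t. s \<in> S \<Longrightarrow> t \<in> S \<Longrightarrow> s * t \<in> S" and "a \<noteq> 0"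
  shows "(cmod (period S a))\<^sup>2 \<le> real CARD('a) - card S"
proof -
  have const: "period S (t * a) = period S a" if "t \<in> S" for t
  proof -
    have t: "t \<noteq> 0"
      using that assms(1) by auto
    then have inj: "inj_on ((*) t) S"
      by (simp add: inj_on_def)
    then have "(*) t ` S = S"
      using that S_mult by (intro endo_inj_surj) auto
    then have "period S a = (\<Sum>s\<in>(*) t ` S. \<psi> (s * a))"
      by (simp add: period_def)
    also have "\<dots> = period S (t * a)"
      by (subst sum.reindex[OF inj]) (simp add: period_def mult_ac)
    finally show ?thesis ..
  qed
  let ?C = "(\<lambda>t. t * a) ` S"
  have card_C: "card ?C = card S"
    using assms(4) by (intro card_image) (simp add: inj_on_def)
  have "(real (card S))\<^sup>2 + card S * (cmod (period S a))\<^sup>2 =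
      (\<Sum>b\<in>insert 0 ?C. (cmod (period S b))\<^sup>2)"
  proof -
    have "0 \<notin> ?C"
      using assms by auto
    moreover have "(\<Sum>b\<in>?C. (cmod (period S b))\<^sup>2) = (\<Sum>b\<in>?C. (cmod (period S a))\<^sup>2)"
      by (intro sum.cong) (auto simp: const)
    ultimately show ?thesis
      using card_C by (simp add: period_0)
  qed
  also have "\<dots> \<le> (\<Sum>b\<in>UNIV. (cmod (period S b))\<^sup>2)"
    by (intro sum_mono2) auto
  finally have "card S * (card S + (cmod (period S a))\<^sup>2) \<le> card S * real CARD('a)"
    unfolding sum_norm_period_squared by (simp add: power2_eq_square algebra_simps)
  moreover have "card S > 0"
    using assms(2) by (simp add: card_gt_0_iff)
  ultimately show ?thesis
    by simp
qed

end

section \<open>The Ramanujan property\<close>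

text \<open>
  The inequality in \<open>bound\<close> says that \<open>q - n \<le> 4 * (n - 1)\<close> for the size \<open>q\<close> of the field.
  It can be dropped for \<open>n = 2\<close>, where the graph is a cycle: the trivial bound \<open>n\<close> on the
  eigenvalues then equals \<open>2 * sqrt (n - 1)\<close>.
\<close>

lemma ramanujan_gen_paley:
  assumes p: "prime p" and card: "CARD('a::{field,finite}) = p ^ m"
    and n: "CARD('a) = k * n + 1" "n \<ge> 2"
    and "k < p"
    and minus_1: "(- 1 :: 'a) \<in> {x ^ k |x. x \<noteq> 0}"
    and bound: "n = 2 \<or> k * n + 1 - n \<le> 4 * (n - 1)"
  shows "ramanujan (gen_paley k :: 'a pair_pre_digraph)"
proof -
  define S where "S = {x ^ k |x::'a. x \<noteq> 0}"
  have kn: "k * n = CARD('a) - 1" "n > 0"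
    using n by auto
  have cardS: "card S = n"
    unfolding S_def using finite_field_powers(1)[OF kn] .
  have S0: "0 \<notin> S" and S_ne: "S \<noteq> {}"
    using cardS kn(2) by (auto simp: S_def simp del: Collect_empty_eq)
  have S_mult: "s * t \<in> S" if "s \<in> S" "t \<in> S" for s t
    using that unfolding S_def by (auto simp flip: power_mult_distrib)
  have S_minus: "- s \<in> S" if "s \<in> S" for s
    using S_mult[of "- 1" s] that minus_1 by (simp add: S_def)
  have "k * n + 1 < (k + 1) * (n + 1)"
    using n by (simp add: algebra_simps)
  also have "\<dots> \<le> p * (n + 1)"
    using \<open>k < p\<close> by (intro mult_le_mono1) simp
  finally have "Digraph_Component.connected (with_proj (cayley_digraph S))"
    using connected_cayley_digraph[OF p card, of S] n(1) cardS S0 S_minus by simp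
  moreover have "pair_graph (cayley_digraph S)"
    using S0 S_minus by (rule pair_graph_cayley_digraph)
  moreover have "regular_graph n (cayley_digraph S)"
    using regular_cayley_digraph[of S] cardS by simp
  moreover have "second_eigenvalue n (cayley_digraph S) \<le> 2 * sqrt (real n - 1)"
  proof -
    obtain \<psi> :: "'a \<Rightarrow> complex" where "additive_character \<psi>"
      using additive_character_exists[OF p card] by blast
    then interpret additive_character \<psi> .
    define E where "E = {cmod \<mu> |\<mu>. \<mu> \<in> graph_spectrum (cayley_digraph S) \<and> cmod \<mu> \<noteq> real n}"
    have E: "E = {cmod (period S a) |a. cmod (period S a) \<noteq> real n}"
      by (auto simp: E_def graph_spectrum_eq_periods)
    have "E \<noteq> {}"
    proof
      assume "E = {}"
      then have "cmod (period S a) = real n" for a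
        by (auto simp: E)
      then have "real CARD('a) * (real n)\<^sup>2 = real CARD('a) * real n"
        using sum_norm_period_squared[of S] cardS by simp
      then show False
        using n(2) by (simp add: power2_eq_square)
    qed
    moreover have "finite E"
      by (simp add: E)
    moreover have "e \<le> 2 * sqrt (real n - 1)" if "e \<in> E" for e
    proof -
      from that obtain a where a: "e = cmod (period S a)" "e \<noteq> real n"
        by (auto simp: E)
      from a have "a \<noteq> 0"
        using cardS by (auto simp: period_0)
      show ?thesis
      proof (cases "n = 2")
        case True
        then show ?thesis
          using a(1) cmod_period_le[of S a] cardS by simp
      next
        case False
        have "e\<^sup>2 \<le> real CARD('a) - n"
          using norm_period_squared_le[OF S0 S_ne S_mult \<open>a \<noteq> 0\<close>] a(1) cardS by simp
        also have "\<dots> \<le> 4 * (real n - 1)"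
        proof -
          have "CARD('a) \<le> n + 4 * (n - 1)"
            using bound False n by linarith
          then have "real CARD('a) \<le> real (n + 4 * (n - 1))"
            by (rule of_nat_mono)
          then show ?thesis
            using n(2) by (simp add: of_nat_diff)
        qed
        finally have "e \<le> sqrt (4 * (real n - 1))"
          by (rule real_le_rsqrt)
        then show ?thesis
          by (simp only: real_sqrt_mult real_sqrt_four)
      qed
    qed
    ultimately show ?thesis
      by (simp add: second_eigenvalue_def flip: E_def)
  qed
  ultimately show ?thesis
    unfolding ramanujan_def gen_paley_def S_def by blast
qed

theorem theorem6p5:
  fixes k p m q :: nat
  assumes "k \<in> {3, 4}"
    and "prime p"
    and "q = p ^ m"
    and "CARD('a::{field,finite}) = q"
    and "[p = 1] (mod k)"
    and "k = 4 \<longrightarrow> even m"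
  shows "ramanujan (gen_paley k :: 'a pair_pre_digraph)"
proof -
  have card: "CARD('a) = p ^ m"
    using assms by simp
  have "card {0, 1 :: 'a} \<le> CARD('a)"
    by (rule card_mono) auto
  then have m: "m > 0"
    using card by (cases m) auto
  have p1: "p > 1"
    using assms(2) prime_gt_1_nat by blast
  have k: "k > 1"
    using assms(1) by auto
  have pow: "\<exists>t. p ^ i = k * t + 1" for i
  proof -
    have "[p ^ i = 1 ^ i] (mod k)"
      using assms(5) by (rule cong_pow)
    then have "p ^ i mod k = 1"
      using k by (simp add: cong_def)
    then show ?thesis
      by (metis mult_div_mod_eq)
  qed
  obtain t where t: "p = k * t + 1"
    using pow[of 1] by auto
  with p1 have "t > 0"
    by (cases t) auto
  then have kp: "k < p"
    using t by (cases t) auto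
  consider "k = 3" | "k = 4"
    using assms(1) by auto
  then show ?thesis
  proof cases
    case 1
    obtain n where n: "p ^ m = 3 * n + 1"
      using pow[of m] 1 by blast
    \<comment> \<open>Since 4 is not prime, the smallest prime of the form \<open>3 * t + 1\<close> is 7.\<close>
    have "p \<noteq> 4"
      using assms(2) by auto
    then have "p \<ge> 7"
      using t 1 \<open>t > 0\<close> by (cases "t = 1") auto
    then have "p ^ m \<ge> 7"
      using self_le_power[of p m] m by linarith
    then have "n \<ge> 2"
      using n by simp
    moreover have "(- 1 :: 'a) \<in> {x ^ 3 |x. x \<noteq> 0}"
      by (intro CollectI exI[of _ "- 1"]) (simp add: power3_eq_cube)
    ultimately show ?thesis
      using ramanujan_gen_paley[OF assms(2) card, of k n] n kp card 1 by fastforce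
  next
    case 2
    obtain i where i: "m = 2 * i"
      using assms(6) 2 by blast
    obtain s where s: "p ^ i = 4 * s + 1"
      using pow[of i] 2 by blast
    define n where "n = 4 * s\<^sup>2 + 2 * s"
    have "p ^ m = (p ^ i)\<^sup>2"
      by (simp add: i power_mult mult.commute)
    then have n: "p ^ m = 4 * n + 1"
      by (simp add: s n_def power2_eq_square algebra_simps)
    have "p ^ i \<noteq> 1"
      using p1 m i by (simp add: power_eq_1_iff)
    then have "s > 0"
      using s by (cases s) auto
    then have "s\<^sup>2 > 0"
      by simp
    then have n6: "n \<ge> 6"
      using \<open>s > 0\<close> unfolding n_def by linarith
    \<comment> \<open>The nonzero fourth powers are the solutions of \<open>x ^ n = 1\<close>, and \<open>n\<close> is even.\<close>
    have "even n"
      by (simp add: n_def)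
    then have "(- 1 :: 'a) \<in> {x ^ 4 |x. x \<noteq> 0}"
      using finite_field_powers(2)[where 'a = 'a, of 4 n] n n6 card by simp
    then show ?thesis
      using ramanujan_gen_paley[OF assms(2) card, of k n] n n6 kp card 2 by simp
  qed
qed

end
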